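(* Let $D\ge 1$, let $N_1,\dots,N_D$ and $M$ be positive integers, and let $\Omega:=\prod_{d=1}^D\mathbb{Z}_{N_d}$. Let $\psi_0:\Omega\to\{1,\dots,M\}$ be any initial segmentation, let $R_1,\dots,R_M:\Omega\to\mathbb{R}$ be any real-valued functions, and let $g:\Omega\to\mathbb{R}$ be a function whose discrete Fourier transform is (real-valued,) nonnegative and even. Then the Active Masks algorithm, i.e. the sequence $\{\psi_i\}_{i\ge 0}$ defined for $i\ge1$ and $n\in\Omega$ by $$\psi_i(n)=\min\Bigl(\operatorname*{argmax}_{1\le m\le M}\bigl[(\mu_m^{(i-1)}*g)(n)+R_m(n)\bigr]\Bigr),$$ where $\mu_m^{(i-1)}(n)=1$ if $\psi_{i-1}(n)=m$ and $\mu_m^{(i-1)}(n)=0$ otherwise, converges to a fixed point of this iteration; that is, there exists $i_0\ge 0$ such that $\psi_i=\psi_{i_0}$ for all $i\ge i_0$.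
   Context: $\mathbb{Z}_{N_d}$ is the group of integers modulo $N_d$. The circular convolution over the finite abelian group $\Omega$ is $(f*g)(n)=\sum_{k\in\Omega}f(k)g(n-k)$. The (non-normalized) discrete Fourier transform of $g$ is $(\mathrm{F}g)(n)=\sum_{k\in\Omega}g(k)\exp\bigl(-2\pi\mathrm{i}\sum_{d=1}^D n_dk_d/N_d\bigr)$, $n\in\Omega$. A function $h$ on $\Omega$ is even if $h(-n)=h(n)$ for all $n\in\Omega$. The expression $\operatorname{argmax}$ denotes the set of all maximizing $m\in\{1,\dots,M\}$, so ties are broken by choosing the smallest maximizing label. *)

theory Defs
  imports Complex_Main "HOL-Algebra.Product_Groups" "HOL-Algebra.Elementary_Groups"
begin

text \<open>
  Elements of \<open>\<Omega>\<close> are functions on \<open>{1..D}\<close> (undefined elsewhere) whose \<open>d\<close>-th value is the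
  residue representative in \<open>{0..<N d}\<close>, provided \<open>N d > 0\<close>. Note that
  \<^const>\<open>integer_mod_group\<close> at \<open>0\<close> is the infinite group of integers.
  The group operation is written multiplicatively, so \<open>n - k\<close> is \<open>n \<otimes> inv k\<close>
  and \<open>-n\<close> is \<open>inv n\<close>.
\<close>

definition Omega :: "nat \<Rightarrow> (nat \<Rightarrow> nat) \<Rightarrow> (nat \<Rightarrow> int) monoid" where
  "Omega D N = product_group {1..D} (\<lambda>d. integer_mod_group (N d))"

definition circ_conv :: "('a, 'b) monoid_scheme \<Rightarrow> ('a \<Rightarrow> real) \<Rightarrow> ('a \<Rightarrow> real) \<Rightarrow> 'a \<Rightarrow> real" where
  "circ_conv G f g n = (\<Sum>k\<in>carrier G. f k * g (n \<otimes>\<^bsub>G\<^esub> inv\<^bsub>G\<^esub> k))"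

definition dft :: "nat \<Rightarrow> (nat \<Rightarrow> nat) \<Rightarrow> ((nat \<Rightarrow> int) \<Rightarrow> real) \<Rightarrow> (nat \<Rightarrow> int) \<Rightarrow> complex" where
  "dft D N g n =
     (\<Sum>k\<in>carrier (Omega D N).
        complex_of_real (g k) *
        exp (- 2 * complex_of_real pi * \<i> *
             (\<Sum>d = 1..D. of_int (n d) * of_int (k d) / of_nat (N d))))"

definition even_on :: "('a, 'b) monoid_scheme \<Rightarrow> ('a \<Rightarrow> 'c) \<Rightarrow> bool" where
  "even_on G h \<longleftrightarrow> (\<forall>n\<in>carrier G. h (inv\<^bsub>G\<^esub> n) = h n)"

definition mask :: "('a \<Rightarrow> nat) \<Rightarrow> nat \<Rightarrow> 'a \<Rightarrow> real" where
  "mask \<psi> m n = (if \<psi> n = m then 1 else 0)"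

text \<open>
  The step is restricted to \<open>carrier G\<close>, so that segmentations form
  \<open>carrier G \<rightarrow>\<^sub>E {1..M}\<close> and equality of segmentations is equality of HOL functions.
\<close>

definition active_masks_step ::
  "('a, 'b) monoid_scheme \<Rightarrow> nat \<Rightarrow> (nat \<Rightarrow> 'a \<Rightarrow> real) \<Rightarrow> ('a \<Rightarrow> real) \<Rightarrow> ('a \<Rightarrow> nat) \<Rightarrow> ('a \<Rightarrow> nat)"
  where
  "active_masks_step G M R g \<psi> =
     (\<lambda>n\<in>carrier G.
        Min {m. is_arg_max (\<lambda>m. circ_conv G (mask \<psi> m) g n + R m n) (\<lambda>m. m \<in> {1..M}) m})"

primrec active_masks ::
  "('a, 'b) monoid_scheme \<Rightarrow> nat \<Rightarrow> (nat \<Rightarrow> 'a \<Rightarrow> real) \<Rightarrow> ('a \<Rightarrow> real) \<Rightarrow> ('a \<Rightarrow> nat)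
     \<Rightarrow> nat \<Rightarrow> ('a \<Rightarrow> nat)"
  where
  "active_masks G M R g \<psi>0 0 = \<psi>0"
| "active_masks G M R g \<psi>0 (Suc i) = active_masks_step G M R g (active_masks G M R g \<psi>0 i)"

end

theory Submission
  imports Defs
begin

text \<open>
  The Active Masks iteration climbs a potential. For a segmentation \<open>\<psi>\<close> with masks \<open>\<mu>\<^sub>m\<close> put
  \<open>E(\<psi>) = \<Sum>\<^sub>m (\<langle>\<mu>\<^sub>m, \<mu>\<^sub>m * g\<rangle> / 2 + \<langle>\<mu>\<^sub>m, R\<^sub>m\<rangle>)\<close>.
  When \<open>g\<close> is even, \<open>\<langle>u, v * g\<rangle>\<close> is a symmetric bilinear form, so expanding \<open>E\<close> around \<open>\<psi>\<close> gives, for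
  the next segmentation with masks \<open>\<mu>'\<^sub>m\<close>,
  \<open>E(\<psi>') - E(\<psi>) = \<Sum>\<^sub>m \<langle>\<mu>'\<^sub>m - \<mu>\<^sub>m, \<mu>\<^sub>m * g + R\<^sub>m\<rangle> + (\<Sum>\<^sub>m \<langle>\<mu>'\<^sub>m - \<mu>\<^sub>m, (\<mu>'\<^sub>m - \<mu>\<^sub>m) * g\<rangle>) / 2\<close>.
  The first sum is the total gain in score from relabelling every point by a maximizing label,
  hence nonnegative; the second is nonnegative when convolution with \<open>g\<close> is positive
  semidefinite. If \<open>E\<close> does not grow, then the old label of every point was already a maximizer,
  and as ties go to the smallest label, labels can only have decreased. So every step that
  changes the segmentation either raises \<open>E\<close> or keeps \<open>E\<close> and lowers the sum of all labels. This
  cannot go on forever among finitely many segmentations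
  (\<open>orbit_reaches_fixpoint\<close>, \<open>active_masks_converges\<close>).

  The Fourier hypothesis enters by the inversion formula
  \<open>|\<Omega>| g(n) = \<Sum>\<^sub>j (F g)(j) \<chi>\<^sub>j(n)\<close> (\<open>dft_inversion\<close>). Complex conjugation turns \<open>\<chi>\<^sub>j(n)\<close> into \<open>\<chi>\<^sub>j(-n)\<close>,
  so a real transform makes \<open>g\<close> even. Moreover
  \<open>|\<Omega>| \<langle>u, u * g\<rangle> = \<Sum>\<^sub>j (F g)(j) |\<Sum>\<^sub>n u(n) \<chi>\<^sub>j(n)|\<^sup>2\<close>, so a nonnegative transform makes convolution
  positive semidefinite.
\<close>

section \<open>Iterations that climb a potential on a finite set\<close>

text \<open>
  Among the points of the orbit take those of maximal \<open>E\<close>, and among these one of minimal \<open>c\<close>: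
  a step away from it would have to improve on one of the two.
\<close>

lemma orbit_reaches_fixpoint:
  fixes x :: "nat \<Rightarrow> 'a" and E :: "'a \<Rightarrow> real" and c :: "'a \<Rightarrow> nat"
  assumes step: "\<And>i. x (Suc i) = f (x i)"
    and fin: "finite (range x)"
    and climb: "\<And>i. f (x i) \<noteq> x i \<Longrightarrow>
        E (x i) < E (f (x i)) \<or> (E (f (x i)) = E (x i) \<and> c (f (x i)) < c (x i))"
  shows "\<exists>i0. f (x i0) = x i0 \<and> (\<forall>i\<ge>i0. x i = x i0)"
proof -
  define P where "P i \<longleftrightarrow> E (x i) = Max (E ` range x)" for i
  have "Max (E ` range x) \<in> E ` range x"
    using fin by (intro Max_in) auto
  then obtain i where "Max (E ` range x) = E (x i)"
    by (elim imageE) simp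
  then have ex: "\<exists>i. P i"
    unfolding P_def by metis
  then obtain i0 where i0: "P i0" and min: "\<And>j. P j \<Longrightarrow> c (x i0) \<le> c (x j)"
    using ex_has_least_nat[of P _ "\<lambda>i. c (x i)"] by blast
  have fix0: "f (x i0) = x i0"
  proof (rule ccontr)
    assume "f (x i0) \<noteq> x i0"
    from climb[OF this] show False
    proof
      assume "E (x i0) < E (f (x i0))"
      moreover have "E (x (Suc i0)) \<le> Max (E ` range x)"
        using fin by (intro Max_ge) auto
      ultimately show False
        using i0 step by (simp add: P_def)
    next
      assume "E (f (x i0)) = E (x i0) \<and> c (f (x i0)) < c (x i0)"
      with i0 min[of "Suc i0"] show False
        by (simp add: P_def step)
    qed
  qed
  have "x i = x i0" if "i0 \<le> i" for i
    using that by (induction i rule: dec_induct) (auto simp: step fix0)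
  with fix0 show ?thesis by blast
qed

section \<open>The energy of a segmentation\<close>

definition positive_semidefinite_conv :: "('a, 'b) monoid_scheme \<Rightarrow> ('a \<Rightarrow> real) \<Rightarrow> bool" where
  "positive_semidefinite_conv G g \<longleftrightarrow>
     (\<forall>u. 0 \<le> (\<Sum>n\<in>carrier G. u n * circ_conv G u g n))"

definition energy ::
  "('a, 'b) monoid_scheme \<Rightarrow> nat \<Rightarrow> (nat \<Rightarrow> 'a \<Rightarrow> real) \<Rightarrow> ('a \<Rightarrow> real) \<Rightarrow> ('a \<Rightarrow> nat) \<Rightarrow> real" where
  "energy G M R g \<psi> =
     (\<Sum>m\<in>{1..M}. \<Sum>n\<in>carrier G. mask \<psi> m n * (circ_conv G (mask \<psi> m) g n / 2 + R m n))"

lemma circ_conv_diff: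
  "circ_conv G (\<lambda>k. u k - v k) g n = circ_conv G u g n - circ_conv G v g n"
  by (simp add: circ_conv_def left_diff_distrib sum_subtractf)

text \<open>
  The entries \<open>g (n - k)\<close> and \<open>g (k - n)\<close> of the convolution matrix agree because
  \<open>k - n\<close> is the inverse of \<open>n - k\<close>.
\<close>

lemma (in group) circ_conv_symmetric:
  assumes "even_on G g"
  shows "(\<Sum>n\<in>carrier G. u n * circ_conv G v g n) = (\<Sum>n\<in>carrier G. v n * circ_conv G u g n)"
proof -
  have swap: "g (n \<otimes> inv k) = g (k \<otimes> inv n)" if "n \<in> carrier G" "k \<in> carrier G" for n k
  proof -
    have "inv (n \<otimes> inv k) = k \<otimes> inv n"
      using that by (simp add: inv_mult_group)
    then show ?thesis
      using assms that unfolding even_on_def by (metis inv_closed m_closed)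
  qed
  have "(\<Sum>n\<in>carrier G. u n * circ_conv G v g n)
      = (\<Sum>n\<in>carrier G. \<Sum>k\<in>carrier G. u n * (v k * g (n \<otimes> inv k)))"
    by (simp add: circ_conv_def sum_distrib_left)
  also have "\<dots> = (\<Sum>k\<in>carrier G. \<Sum>n\<in>carrier G. u n * (v k * g (n \<otimes> inv k)))"
    by (rule sum.swap)
  also have "\<dots> = (\<Sum>k\<in>carrier G. v k * circ_conv G u g k)"
    unfolding circ_conv_def sum_distrib_left
    by (intro sum.cong refl) (simp add: swap mult.left_commute)
  finally show ?thesis .
qed

text \<open>
  A quadratic function with positive semidefinite quadratic part is convex, so it lies above its
  tangent at \<open>u\<close>; the gradient there is \<open>u * g + r\<close>.
\<close>

lemma (in group) quadratic_gain_ge_linear_gain: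
  assumes "even_on G g" and "positive_semidefinite_conv G g"
  shows "(\<Sum>n\<in>carrier G. (v n - u n) * (circ_conv G u g n + r n))
       \<le> (\<Sum>n\<in>carrier G. v n * (circ_conv G v g n / 2 + r n))
         - (\<Sum>n\<in>carrier G. u n * (circ_conv G u g n / 2 + r n))"
proof -
  define B where "B a b = (\<Sum>n\<in>carrier G. a n * circ_conv G b g n)" for a b
  have "0 \<le> B (\<lambda>n. v n - u n) (\<lambda>n. v n - u n)"
    using assms(2) by (simp only: B_def positive_semidefinite_conv_def)
  also have "\<dots> = B v v - B v u - (B u v - B u u)"
    by (simp add: B_def circ_conv_diff algebra_simps sum_subtractf sum.distrib)
  also have "B u v = B v u"
    unfolding B_def by (rule circ_conv_symmetric[OF assms(1)])
  finally have *: "2 * B v u - B u u \<le> B v v"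
    by simp
  have half: "(\<Sum>n\<in>carrier G. a n * (circ_conv G a g n / 2 + r n))
      = B a a / 2 + (\<Sum>n\<in>carrier G. a n * r n)" for a
    by (simp add: B_def distrib_left sum.distrib sum_divide_distrib)
  have "(\<Sum>n\<in>carrier G. (v n - u n) * (circ_conv G u g n + r n))
      = B v u - B u u + ((\<Sum>n\<in>carrier G. v n * r n) - (\<Sum>n\<in>carrier G. u n * r n))"
    by (simp add: B_def algebra_simps sum_subtractf sum.distrib)
  with * show ?thesis
    by (simp add: half)
qed

lemma sum_mask_mult:
  assumes "\<psi> n \<in> {1..M}"
  shows "(\<Sum>m\<in>{1..M}. mask \<psi> m n * F m) = F (\<psi> n)"
proof -
  have "(\<Sum>m\<in>{1..M}. mask \<psi> m n * F m) = (\<Sum>m\<in>{1..M}. if \<psi> n = m then F m else 0)"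
    by (intro sum.cong) (auto simp: mask_def)
  then show ?thesis
    using assms by simp
qed

lemma Min_is_arg_max:
  fixes F :: "nat \<Rightarrow> real"
  assumes "0 < M"
  defines "l \<equiv> Min {m. is_arg_max F (\<lambda>m. m \<in> {1..M}) m}"
  shows "l \<in> {1..M}"
    and "\<And>m. m \<in> {1..M} \<Longrightarrow> F m \<le> F l"
    and "\<And>m. m \<in> {1..M} \<Longrightarrow> F m = F l \<Longrightarrow> l \<le> m"
proof -
  define S where "S = {m. is_arg_max F (\<lambda>m. m \<in> {1..M}) m}"
  have fin: "finite S"
    by (rule finite_subset[of _ "{1..M}"]) (auto simp: S_def is_arg_max_def)
  have "Max (F ` {1..M}) \<in> F ` {1..M}"
    using assms(1) by (intro Max_in) auto
  then obtain m where m: "Max (F ` {1..M}) = F m" "m \<in> {1..M}"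
    by (rule imageE)
  have "F k \<le> F m" if "k \<in> {1..M}" for k
    unfolding m(1)[symmetric] using that by (intro Max_ge) auto
  with m have "m \<in> S"
    by (auto simp: S_def is_arg_max_linorder)
  with fin have l: "l \<in> S"
    unfolding l_def S_def[symmetric] by (intro Min_in) auto
  then show "l \<in> {1..M}" and ge: "\<And>m. m \<in> {1..M} \<Longrightarrow> F m \<le> F l"
    by (auto simp: S_def is_arg_max_linorder)
  show "l \<le> m" if "m \<in> {1..M}" "F m = F l" for m
  proof -
    have "m \<in> S"
      using that ge by (auto simp: S_def is_arg_max_linorder)
    then show ?thesis
      unfolding l_def S_def[symmetric] using fin by simp
  qed
qed

lemma active_masks_step_in_PiE:
  assumes "0 < M"
  shows "active_masks_step G M R g \<psi> \<in> carrier G \<rightarrow>\<^sub>E {1..M}"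
  unfolding active_masks_step_def using Min_is_arg_max(1)[OF assms]
  by (intro restrict_PiE_iff[THEN iffD2]) blast

text \<open>
  The energy grows at least by the sum of the pointwise gains in score. If it does not grow, all
  these gains vanish, so the old labels were maximizers as well and the minimum over all
  maximizers is at most the old label.
\<close>

lemma (in group) active_masks_step_climbs:
  assumes M: "0 < M" and fin: "finite (carrier G)"
    and even: "even_on G g" and psd: "positive_semidefinite_conv G g"
    and \<psi>: "\<psi> \<in> carrier G \<rightarrow>\<^sub>E {1..M}"
    and moved: "active_masks_step G M R g \<psi> \<noteq> \<psi>"
  defines "\<psi>' \<equiv> active_masks_step G M R g \<psi>"
  shows "energy G M R g \<psi> < energy G M R g \<psi>' \<or>
    (energy G M R g \<psi>' = energy G M R g \<psi> \<and>
     (\<Sum>n\<in>carrier G. \<psi>' n) < (\<Sum>n\<in>carrier G. \<psi> n))"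
proof -
  define F where "F n m = circ_conv G (mask \<psi> m) g n + R m n" for n m
  define gain where "gain n = F n (\<psi>' n) - F n (\<psi> n)" for n
  have \<psi>'_eq: "\<psi>' n = Min {m. is_arg_max (F n) (\<lambda>m. m \<in> {1..M}) m}" if "n \<in> carrier G" for n
    using that unfolding \<psi>'_def active_masks_step_def F_def by simp
  have \<psi>': "\<psi>' \<in> carrier G \<rightarrow>\<^sub>E {1..M}"
    unfolding \<psi>'_def by (rule active_masks_step_in_PiE[OF M])
  have lab: "\<psi> n \<in> {1..M}" "\<psi>' n \<in> {1..M}" if "n \<in> carrier G" for n
    using PiE_mem[OF \<psi> that] PiE_mem[OF \<psi>' that] .
  have gain_nonneg: "0 \<le> gain n" if "n \<in> carrier G" for n
    using Min_is_arg_max(2)[OF M lab(1)[OF that], of "F n"] \<psi>'_eq[OF that]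
    by (simp add: gain_def)

  have "(\<Sum>n\<in>carrier G. gain n)
      = (\<Sum>n\<in>carrier G. \<Sum>m\<in>{1..M}. (mask \<psi>' m n - mask \<psi> m n) * F n m)"
    by (intro sum.cong refl)
      (simp only: gain_def left_diff_distrib sum_subtractf sum_mask_mult lab)
  also have "\<dots> = (\<Sum>m\<in>{1..M}. \<Sum>n\<in>carrier G. (mask \<psi>' m n - mask \<psi> m n) * F n m)"
    by (rule sum.swap)
  also have "\<dots> \<le> energy G M R g \<psi>' - energy G M R g \<psi>"
    unfolding energy_def F_def
    by (subst sum_subtractf[symmetric], rule sum_mono, rule quadratic_gain_ge_linear_gain[OF even psd])
  finally have le: "(\<Sum>n\<in>carrier G. gain n) \<le> energy G M R g \<psi>' - energy G M R g \<psi>" .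
  have total_nonneg: "0 \<le> (\<Sum>n\<in>carrier G. gain n)"
    by (intro sum_nonneg gain_nonneg)

  show ?thesis
  proof (cases "energy G M R g \<psi> < energy G M R g \<psi>'")
    case False
    with le total_nonneg have eq: "energy G M R g \<psi>' = energy G M R g \<psi>"
      and total0: "(\<Sum>n\<in>carrier G. gain n) = 0"
      by linarith+
    have gain0: "gain n = 0" if "n \<in> carrier G" for n
      using sum_nonneg_0[OF fin gain_nonneg total0 that] .
    have dec: "\<psi>' n \<le> \<psi> n" if "n \<in> carrier G" for n
      using Min_is_arg_max(3)[OF M lab(1)[OF that], of "F n"] gain0[OF that] \<psi>'_eq[OF that]
      by (simp add: gain_def)
    have "\<exists>n\<in>carrier G. \<psi>' n < \<psi> n"
    proof (rule ccontr)
      assume "\<not> (\<exists>n\<in>carrier G. \<psi>' n < \<psi> n)"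
      then have "\<psi>' n = \<psi> n" if "n \<in> carrier G" for n
        using dec[OF that] that by (meson le_neq_implies_less)
      then have "\<psi>' = \<psi>"
        by (rule PiE_ext[OF \<psi>' \<psi>])
      with moved show False
        by (simp only: \<psi>'_def)
    qed
    with dec have "(\<Sum>n\<in>carrier G. \<psi>' n) < (\<Sum>n\<in>carrier G. \<psi> n)"
      by (intro sum_strict_mono_ex1[OF fin]) blast+
    with eq show ?thesis by blast
  qed simp
qed

theorem (in group) active_masks_converges:
  assumes "0 < M" and fin: "finite (carrier G)"
    and "even_on G g" and "positive_semidefinite_conv G g"
    and \<psi>0: "\<psi>0 \<in> carrier G \<rightarrow>\<^sub>E {1..M}"
  shows "\<exists>i0. active_masks_step G M R g (active_masks G M R g \<psi>0 i0) = active_masks G M R g \<psi>0 i0 \<and>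
              (\<forall>i\<ge>i0. active_masks G M R g \<psi>0 i = active_masks G M R g \<psi>0 i0)"
proof -
  have in_PiE: "active_masks G M R g \<psi>0 i \<in> carrier G \<rightarrow>\<^sub>E {1..M}" for i
    by (cases i) (simp_all only: active_masks.simps \<psi>0 active_masks_step_in_PiE[OF assms(1)])
  have "range (active_masks G M R g \<psi>0) \<subseteq> carrier G \<rightarrow>\<^sub>E {1..M}"
    using in_PiE by (rule image_subsetI)
  moreover have "finite (carrier G \<rightarrow>\<^sub>E {1..M})"
    using fin by (intro finite_PiE finite_atLeastAtMost)
  ultimately have fin_range: "finite (range (active_masks G M R g \<psi>0))"
    by (rule finite_subset)
  show ?thesis
  proof (rule orbit_reaches_fixpoint[where f = "active_masks_step G M R g" and E = "energy G M R g"
        and c = "\<lambda>\<psi>. \<Sum>n\<in>carrier G. \<psi> n"])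
    show "active_masks G M R g \<psi>0 (Suc i) = active_masks_step G M R g (active_masks G M R g \<psi>0 i)" for i
      by simp
  qed (fact fin_range, rule active_masks_step_climbs[OF assms(1-4) in_PiE])
qed

section \<open>Characters of a product of cyclic groups\<close>

definition character :: "nat \<Rightarrow> (nat \<Rightarrow> nat) \<Rightarrow> (nat \<Rightarrow> int) \<Rightarrow> (nat \<Rightarrow> int) \<Rightarrow> complex" where
  "character D N j n = (\<Prod>d=1..D. cis (2 * pi * (of_int (j d * n d) / of_nat (N d))))"

lemma cnj_character: "cnj (character D N j n) = character D N j (\<lambda>d. - n d)"
  by (simp add: character_def cis_cnj)

lemma character_diff:
  "character D N j (\<lambda>d. n d - k d) = character D N j n * cnj (character D N j k)"
  unfolding cnj_character
  unfolding character_def prod.distrib[symmetric] cis_mult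
  by (intro prod.cong refl arg_cong[of _ _ cis])
    (simp add: algebra_simps add_divide_distrib diff_divide_distrib)

lemma cis_of_int_div_cong:
  assumes "0 < N" "a mod int N = b mod int N"
  shows "cis (2 * pi * (of_int (j * a) / of_nat N)) = cis (2 * pi * (of_int (j * b) / of_nat N))"
proof -
  obtain q where q: "a = b + int N * q"
    using assms(2) by (metis mod_eq_dvd_iff dvdE diff_add_cancel add.commute)
  have "2 * pi * (of_int (j * a) / of_nat N)
      = 2 * pi * (of_int (j * b) / of_nat N) + 2 * pi * of_int (j * q)"
    using assms(1) by (simp add: q field_simps)
  then show ?thesis
    by (simp flip: cis_mult)
qed

lemma character_cong:
  assumes "\<forall>d\<in>{1..D}. 0 < N d"
    and "\<And>d. d \<in> {1..D} \<Longrightarrow> n d mod int (N d) = n' d mod int (N d)"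
  shows "character D N j n = character D N j n'"
  unfolding character_def using assms by (intro prod.cong refl cis_of_int_div_cong) auto

text \<open>
  The summands are the powers of \<open>z = cis (2 * pi * a / N)\<close>, where \<open>z ^ N = 1\<close>; so the geometric
  sum vanishes unless \<open>z = 1\<close>, that is, unless \<open>N\<close> divides \<open>a\<close>.
\<close>

lemma sum_cis_of_int_div:
  assumes N: "0 < N"
  shows "(\<Sum>j\<in>{0..<int N}. cis (2 * pi * (of_int (j * a) / of_nat N)))
       = (if int N dvd a then of_nat N else 0)"
proof -
  define z where "z = cis (2 * pi * (of_int a / of_nat N))"
  have "(\<Sum>j\<in>{0..<int N}. cis (2 * pi * (of_int (j * a) / of_nat N))) = (\<Sum>i<N. z ^ i)"
    by (rule sum.reindex_bij_witness[of _ int nat]) (auto simp: z_def DeMoivre algebra_simps)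
  also have "\<dots> = (if int N dvd a then of_nat N else 0)"
  proof (cases "int N dvd a")
    case True
    then obtain q where "a = int N * q" by blast
    then have "z = 1"
      using N by (simp add: z_def)
    with True show ?thesis by simp
  next
    case False
    have "z \<noteq> 1"
    proof
      assume "z = 1"
      then have "cos (2 * pi * (of_int a / of_nat N)) = 1"
        unfolding z_def by (metis cis.sel(1) one_complex.sel(1))
      then obtain q :: int where "2 * pi * (of_int a / of_nat N) = of_int q * 2 * pi"
        using cos_one_2pi_int by blast
      then have "real_of_int a = of_int (q * int N)"
        using N by (simp add: field_simps)
      then have "a = q * int N"
        by (simp only: of_int_eq_iff)
      with False show False by simp
    qed
    moreover have "z ^ N = 1"
      using N by (simp add: z_def DeMoivre)
    ultimately show ?thesis
      using False by (simp add: sum_gp_strict)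
  qed
  finally show ?thesis .
qed

lemma carrier_Omega:
  assumes "\<forall>d\<in>{1..D}. 0 < N d"
  shows "carrier (Omega D N) = (\<Pi>\<^sub>E d\<in>{1..D}. {0..<int (N d)})"
  unfolding Omega_def carrier_product_group
  by (intro PiE_cong) (use assms in \<open>auto simp: carrier_integer_mod_group\<close>)

lemma group_Omega: "group (Omega D N)"
  by (simp add: Omega_def)

lemma inv_Omega:
  assumes "n \<in> carrier (Omega D N)"
  shows "inv\<^bsub>Omega D N\<^esub> n = (\<lambda>d\<in>{1..D}. (- n d) mod int (N d))"
  using assms unfolding Omega_def
  by (subst inv_product_group) (auto intro!: restrict_ext inv_integer_mod_group)

lemma character_inv_Omega:
  assumes pos: "\<forall>d\<in>{1..D}. 0 < N d" and "n \<in> carrier (Omega D N)"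
  shows "character D N j (inv\<^bsub>Omega D N\<^esub> n) = cnj (character D N j n)"
  unfolding cnj_character inv_Omega[OF assms(2)]
  by (intro character_cong pos) (auto simp: mod_simps)

lemma character_diff_Omega:
  assumes pos: "\<forall>d\<in>{1..D}. 0 < N d"
    and "k \<in> carrier (Omega D N)"
  shows "character D N j (n \<otimes>\<^bsub>Omega D N\<^esub> inv\<^bsub>Omega D N\<^esub> k)
       = character D N j n * cnj (character D N j k)"
  unfolding character_diff[symmetric] inv_Omega[OF assms(2)]
  by (intro character_cong pos) (auto simp: Omega_def mod_simps)

text \<open>
  The sum over the product set factors into one geometric sum per coordinate, and two points of
  \<open>\<Omega>\<close> that agree modulo every \<open>N d\<close> are equal because their entries are reduced.
\<close>

lemma character_orthogonality:
  assumes pos: "\<forall>d\<in>{1..D}. 0 < N d"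
    and n: "n \<in> carrier (Omega D N)" and k: "k \<in> carrier (Omega D N)"
  shows "(\<Sum>j\<in>carrier (Omega D N). character D N j n * cnj (character D N j k))
       = (if n = k then of_nat (\<Prod>d=1..D. N d) else 0)"
proof -
  have "(\<Sum>j\<in>carrier (Omega D N). character D N j n * cnj (character D N j k))
      = (\<Sum>j\<in>(\<Pi>\<^sub>E d\<in>{1..D}. {0..<int (N d)}). character D N j (\<lambda>d. n d - k d))"
    by (simp only: character_diff carrier_Omega[OF pos])
  also have "\<dots> = (\<Prod>d=1..D. \<Sum>i\<in>{0..<int (N d)}.
                    cis (2 * pi * (of_int (i * (n d - k d)) / of_nat (N d))))"
    unfolding character_def by (subst prod_sum_PiE) auto
  also have "\<dots> = (\<Prod>d=1..D. if int (N d) dvd n d - k d then of_nat (N d) else 0)"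
    using pos by (intro prod.cong refl sum_cis_of_int_div) auto
  also have "\<dots> = (if n = k then of_nat (\<Prod>d=1..D. N d) else 0)"
  proof (cases "n = k")
    case False
    have nk: "n \<in> (\<Pi>\<^sub>E d\<in>{1..D}. {0..<int (N d)})" "k \<in> (\<Pi>\<^sub>E d\<in>{1..D}. {0..<int (N d)})"
      using n k by (simp_all only: carrier_Omega[OF pos])
    have "\<exists>d\<in>{1..D}. n d \<noteq> k d"
      using False PiE_ext[OF nk] by metis
    then obtain d where d: "d \<in> {1..D}" "n d \<noteq> k d" by (rule bexE)
    have "\<not> int (N d) dvd n d - k d"
      using PiE_mem[OF nk(1) d(1)] PiE_mem[OF nk(2) d(1)] d(2) by (simp flip: mod_eq_dvd_iff)
    then have "\<exists>d\<in>{1..D}. (if int (N d) dvd n d - k d then of_nat (N d) else 0 :: complex) = 0"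
      using d(1) by (intro bexI[of _ d]) simp_all
    then show ?thesis
      using False by (simp only: prod_zero[OF finite_atLeastAtMost] if_False)
  qed simp
  finally show ?thesis .
qed

section \<open>Fourier inversion and its consequences\<close>

lemma dft_eq_character_sum:
  "dft D N g j = (\<Sum>k\<in>carrier (Omega D N). of_real (g k) * cnj (character D N j k))"
  unfolding dft_def
proof (intro sum.cong refl arg_cong2[of _ _ _ _ "(*)"])
  fix k
  have "exp (- 2 * complex_of_real pi * \<i> *
          (\<Sum>d = 1..D. of_int (j d) * of_int (k d) / of_nat (N d)))
      = (\<Prod>d = 1..D. exp (- 2 * complex_of_real pi * \<i> * (of_int (j d) * of_int (k d) / of_nat (N d))))"
    by (simp only: sum_distrib_left exp_sum finite_atLeastAtMost)
  also have "\<dots> = cnj (character D N j k)"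
    unfolding character_def cnj_prod cis_cnj
    unfolding cis_conv_exp
    by (intro prod.cong refl arg_cong[of _ _ exp]) (simp add: algebra_simps)
  finally show "exp (- 2 * complex_of_real pi * \<i> *
          (\<Sum>d = 1..D. of_int (j d) * of_int (k d) / of_nat (N d)))
      = cnj (character D N j k)" .
qed

lemma finite_carrier_Omega:
  assumes "\<forall>d\<in>{1..D}. 0 < N d"
  shows "finite (carrier (Omega D N))"
  unfolding carrier_Omega[OF assms] by (intro finite_PiE) auto

lemma dft_inversion:
  assumes pos: "\<forall>d\<in>{1..D}. 0 < N d" and n: "n \<in> carrier (Omega D N)"
  shows "(\<Sum>j\<in>carrier (Omega D N). dft D N g j * character D N j n)
       = of_nat (\<Prod>d=1..D. N d) * of_real (g n)"
proof -
  let ?C = "carrier (Omega D N)"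
  have "(\<Sum>j\<in>?C. dft D N g j * character D N j n)
      = (\<Sum>j\<in>?C. \<Sum>k\<in>?C. of_real (g k) * (character D N j n * cnj (character D N j k)))"
    unfolding dft_eq_character_sum sum_distrib_right by (simp add: mult_ac)
  also have "\<dots> = (\<Sum>k\<in>?C. of_real (g k) * (\<Sum>j\<in>?C. character D N j n * cnj (character D N j k)))"
    by (subst sum.swap) (simp add: sum_distrib_left)
  also have "\<dots> = (\<Sum>k\<in>?C. of_real (g k) * (if n = k then of_nat (\<Prod>d=1..D. N d) else 0))"
    by (intro sum.cong refl arg_cong2[of _ _ _ _ "(*)"] character_orthogonality pos n)
  also have "\<dots> = (\<Sum>k\<in>?C. if n = k then of_nat (\<Prod>d=1..D. N d) * of_real (g n) else 0)"
    by (intro sum.cong) auto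
  also have "\<dots> = of_nat (\<Prod>d=1..D. N d) * of_real (g n)"
    using n finite_carrier_Omega[OF pos] by simp
  finally show ?thesis .
qed

text \<open>
  Inverting at \<open>-n\<close> instead of \<open>n\<close> conjugates the characters, and the coefficients are their own
  conjugates, so \<open>g (-n)\<close> is the conjugate of the real number \<open>g n\<close>.
\<close>

lemma even_on_if_dft_real:
  assumes pos: "\<forall>d\<in>{1..D}. 0 < N d"
    and real: "\<And>j. j \<in> carrier (Omega D N) \<Longrightarrow> dft D N g j \<in> \<real>"
  shows "even_on (Omega D N) g"
  unfolding even_on_def
proof
  fix n assume n: "n \<in> carrier (Omega D N)"
  let ?C = "carrier (Omega D N)" and ?P = "\<Prod>d=1..D. N d"
  have inv: "inv\<^bsub>Omega D N\<^esub> n \<in> ?C"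
    using group.inv_closed[OF group_Omega n] .
  have "of_nat ?P * complex_of_real (g (inv\<^bsub>Omega D N\<^esub> n))
      = (\<Sum>j\<in>?C. dft D N g j * cnj (character D N j n))"
    by (simp only: dft_inversion[OF pos inv, symmetric] character_inv_Omega[OF pos n])
  also have "\<dots> = cnj (\<Sum>j\<in>?C. dft D N g j * character D N j n)"
    using real by (simp add: Reals_cnj_iff)
  also have "\<dots> = of_nat ?P * complex_of_real (g n)"
    by (simp only: dft_inversion[OF pos n]) simp
  finally have "of_nat ?P * complex_of_real (g (inv\<^bsub>Omega D N\<^esub> n))
      = of_nat ?P * complex_of_real (g n)" .
  moreover have "?P \<noteq> 0"
    using pos by force
  ultimately show "g (inv\<^bsub>Omega D N\<^esub> n) = g n"
    by (simp only: mult_cancel_left of_nat_eq_0_iff of_real_eq_iff) simp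
qed

text \<open>
  The characters diagonalize convolution: after inversion, the factor
  \<open>\<chi>\<^sub>j(n - k) = \<chi>\<^sub>j(n) * cnj (\<chi>\<^sub>j(k))\<close> splits the double sum over \<open>n\<close> and \<open>k\<close> into \<open>S j * cnj (S j)\<close>,
  where \<open>S j\<close> is the coefficient of \<open>u\<close> at \<open>j\<close>.
\<close>

lemma positive_semidefinite_conv_if_dft_nonneg:
  assumes pos: "\<forall>d\<in>{1..D}. 0 < N d"
    and nonneg: "\<And>j. j \<in> carrier (Omega D N) \<Longrightarrow> dft D N g j \<in> \<real> \<and> Re (dft D N g j) \<ge> 0"
  shows "positive_semidefinite_conv (Omega D N) g"
  unfolding positive_semidefinite_conv_def
proof
  fix u :: "(nat \<Rightarrow> int) \<Rightarrow> real"
  let ?G = "Omega D N"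
  let ?C = "carrier ?G" and ?P = "\<Prod>d=1..D. N d"
  let ?\<chi> = "character D N"
  define S where "S j = (\<Sum>n\<in>?C. of_real (u n) * ?\<chi> j n)" for j
  interpret group ?G by (rule group_Omega)
  have "complex_of_real (of_nat ?P * (\<Sum>n\<in>?C. u n * circ_conv ?G u g n))
      = (\<Sum>n\<in>?C. \<Sum>k\<in>?C. of_real (u n) * of_real (u k) *
           (of_nat ?P * of_real (g (n \<otimes>\<^bsub>?G\<^esub> inv\<^bsub>?G\<^esub> k))))"
    by (simp add: circ_conv_def sum_distrib_left mult_ac)
  also have "\<dots> = (\<Sum>n\<in>?C. \<Sum>k\<in>?C. of_real (u n) * of_real (u k) *
           (\<Sum>j\<in>?C. dft D N g j * (?\<chi> j n * cnj (?\<chi> j k))))"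
    by (intro sum.cong refl arg_cong2[of _ _ _ _ "(*)"])
      (simp only: dft_inversion[OF pos, symmetric] m_closed inv_closed
        character_diff_Omega[OF pos])
  also have "\<dots> = (\<Sum>n\<in>?C. \<Sum>j\<in>?C. \<Sum>k\<in>?C.
           dft D N g j * ((of_real (u n) * ?\<chi> j n) * cnj (of_real (u k) * ?\<chi> j k)))"
    unfolding sum_distrib_left by (subst (2) sum.swap) (simp add: mult_ac)
  also have "\<dots> = (\<Sum>j\<in>?C. \<Sum>n\<in>?C. \<Sum>k\<in>?C.
           dft D N g j * ((of_real (u n) * ?\<chi> j n) * cnj (of_real (u k) * ?\<chi> j k)))"
    by (rule sum.swap)
  also have "\<dots> = (\<Sum>j\<in>?C. dft D N g j * (S j * cnj (S j)))"
    unfolding S_def cnj_sum sum_product by (simp only: sum_distrib_left)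
  also have "\<dots> = (\<Sum>j\<in>?C. of_real (Re (dft D N g j) * (cmod (S j))\<^sup>2))"
  proof (intro sum.cong refl)
    fix j assume "j \<in> ?C"
    then have "dft D N g j = of_real (Re (dft D N g j))"
      using nonneg by (simp add: of_real_Re)
    then show "dft D N g j * (S j * cnj (S j)) = of_real (Re (dft D N g j) * (cmod (S j))\<^sup>2)"
      by (simp only: complex_norm_square[symmetric] of_real_mult)
  qed
  finally have "of_nat ?P * (\<Sum>n\<in>?C. u n * circ_conv ?G u g n)
      = (\<Sum>j\<in>?C. Re (dft D N g j) * (cmod (S j))\<^sup>2)"
    by (simp only: of_real_sum[symmetric] of_real_eq_iff)
  also have "\<dots> \<ge> 0"
    using nonneg by (intro sum_nonneg mult_nonneg_nonneg) auto
  finally have "0 \<le> of_nat ?P * (\<Sum>n\<in>?C. u n * circ_conv ?G u g n)" .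
  moreover have "0 < ?P"
    using pos by (intro prod_pos) auto
  ultimately show "0 \<le> (\<Sum>n\<in>?C. u n * circ_conv ?G u g n)"
    by (metis of_nat_0_less_iff zero_le_mult_iff not_less)
qed

section \<open>Convergence of Active Masks\<close>

theorem theorem1p1:
  fixes D M :: nat
    and N :: "nat \<Rightarrow> nat"
    and \<psi>0 :: "(nat \<Rightarrow> int) \<Rightarrow> nat"
    and R :: "nat \<Rightarrow> (nat \<Rightarrow> int) \<Rightarrow> real"
    and g :: "(nat \<Rightarrow> int) \<Rightarrow> real"
  assumes "D \<ge> 1"
    and "\<And>d. d \<in> {1..D} \<Longrightarrow> N d > 0"
    and "M > 0"
    and "\<psi>0 \<in> carrier (Omega D N) \<rightarrow>\<^sub>E {1..M}"
    and "\<And>n. n \<in> carrier (Omega D N) \<Longrightarrow> dft D N g n \<in> \<real> \<and> Re (dft D N g n) \<ge> 0"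
    and "even_on (Omega D N) (dft D N g)"
  shows "\<exists>i0. active_masks_step (Omega D N) M R g (active_masks (Omega D N) M R g \<psi>0 i0)
                = active_masks (Omega D N) M R g \<psi>0 i0 \<and>
              (\<forall>i\<ge>i0. active_masks (Omega D N) M R g \<psi>0 i
                = active_masks (Omega D N) M R g \<psi>0 i0)"
proof (rule group.active_masks_converges[OF group_Omega])
  show "0 < M" and "\<psi>0 \<in> carrier (Omega D N) \<rightarrow>\<^sub>E {1..M}"
    by fact+
  show "finite (carrier (Omega D N))"
    using assms(2) by (intro finite_carrier_Omega) blast
  show "even_on (Omega D N) g"
    using assms(2,5) by (intro even_on_if_dft_real) auto
  show "positive_semidefinite_conv (Omega D N) g"
    using assms(2,5) by (intro positive_semidefinite_conv_if_dft_nonneg) blast+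
qed

end
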